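(* For any problem instance $(F_\beta, F_\gamma, N, s)$ (equivalently $(\beta,\gamma,N,s)$), the unique equilibrium queueing profile $\hat Q$ is unstable with respect to the class of ordered local pressure-related (OLP) dynamics. That is, among the OLP mappings $Y:\mathcal{Q}\to\mathcal{Q}$ with $Y(\hat Q)=\hat Q$ there is no converging mapping.
   Context: Problem instance. $N>0$ (mass of travelers) and $s>0$ (bottleneck capacity) are real numbers. Travelers are indexed by $n\in[0,N]$. $\beta:[0,N]\to(0,1)$ is continuous and strictly increasing (earliness penalty; $\beta(n)=F_\beta^{-1}(n/N)$ where $F_\beta$ is the CDF of the earliness penalty), and $\gamma:[0,N]\to(0,\infty)$ is continuous and strictly decreasing (lateness penalty; $\gamma(n)=\tilde F_\gamma^{-1}(n/N)$ where $\tilde F_\gamma=1-F_\gamma$ and $F_\gamma$ is the CDF of the lateness penalty). Write $[x]^+=\max\{x,0\}$. For a queueing profile $Q$, the cost of traveler $n$ when arriving at time $t$ is $C_n(t\mid Q)=Q(t)+\beta(n)[-t]^+ +\gamma(n)[t]^+$. Equilibrium profile. Let $N_1\in(0,N)$ be the unique number with $\int_0^{N_1}\beta(n)\,dn=\int_{N_1}^N\gamma(n)\,dn$, and set $\tau_s=-N_1/s$, $\tau_e=\tau_s+N/s$, $\mathcal{T}=[\tau_s,\tau_e]$, and $n(t)=N_1+st$ for $t\in\mathcal{T}$ (the index of the traveler arriving at time $t$). The equilibrium profile $\hat Q:\mathcal{T}\to[0,\infty)$ is $\hat Q(t)=\frac1s\int_0^{n(t)}\beta(n)\,dn$ for $t\in[\tau_s,0]$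 and $\hat Q(t)=\hat Q(0)-\frac1s\int_{N_1}^{n(t)}\gamma(n)\,dn$ for $t\in(0,\tau_e]$. Admissible profiles. $\mathcal{Q}$ is the class of functions $Q:\mathcal{T}\to[0,\infty)$ such that: (1) $Q>0$ on the interior of $\mathcal{T}$ and $Q(\tau_s)=Q(\tau_e)=0$; (2) $Q$ is continuous and piecewise continuously differentiable on $\mathcal{T}$ (finitely many pieces); (3) $Q(t_2)-Q(t_1)<t_2-t_1$ for all $t_1<t_2$ in $\mathcal{T}$. Dynamics. An ordered dynamic process is a mapping $Y:\mathcal{Q}\to\mathcal{Q}$. It is ordered local pressure-related (OLP) if for all $Q_A\in\mathcal{Q}$, with $Q_B=Y(Q_A)$, and for all $t\in\operatorname{int}\mathcal{T}$, $t\neq0$, at which $Q_A$ is differentiable, $[Q_B(t)-Q_A(t)]\cdot C'_{n(t)}(t\mid Q_A)\ge 0$. Here $C'_{n(t)}(t\mid Q_A)$ is the derivative with respect to $u$ of $u\mapsto C_m(u\mid Q_A)$ at $u=t$, with the index $m=n(t)$ held fixed; thus it equals $Q_A'(t)-\beta(n(t))$ for $t<0$ and $Q_A'(t)+\gamma(n(t))$ for $t>0$. Distance and stability. $d(Q_1,Q_2)=\max_{t\in\mathcal{T}}|Q_1(t)-Q_2(t)|$. A mapping $Y:\mathcal{Q}\to\mathcal{Q}$ with $Y(\hat Q)=\hat Q$ is converging if there is $\epsilon>0$ such that for every $Q\in\mathcal{Q}$ with $d(Q,\hat Q)<\epsilon$ the sequence of iterates $Y^k(Q)$ converges to $\hat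 Q$ (in $d$) as $k\to\infty$. $\hat Q$ is unstable with respect to a class of ordered dynamics, all having $\hat Q$ as a fixed point, if the class contains no converging mapping. *)

theory Defs
  imports "HOL-Analysis.Analysis"
begin

locale bottleneck =
  fixes \<beta> \<gamma> :: "real \<Rightarrow> real" and N s :: real
  assumes N_pos: "0 < N" and s_pos: "0 < s"
    and beta_range: "\<beta> \<in> {0..N} \<rightarrow> {0<..<1}"
    and beta_cont: "continuous_on {0..N} \<beta>"
    and beta_mono: "strict_mono_on {0..N} \<beta>"
    and gamma_range: "\<gamma> \<in> {0..N} \<rightarrow> {0<..}"
    and gamma_cont: "continuous_on {0..N} \<gamma>"
    and gamma_antimono: "strict_antimono_on {0..N} \<gamma>"
begin

definition N1 :: real where
  "N1 = (THE x. x \<in> {0<..<N} \<and> integral {0..x} \<beta> = integral {x..N} \<gamma>)"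

definition tau_s :: real where "tau_s = - N1 / s"

definition tau_e :: real where "tau_e = tau_s + N / s"

definition T :: "real set" where "T = {tau_s..tau_e}"

definition idx :: "real \<Rightarrow> real" where "idx t = N1 + s * t"

definition cost :: "(real \<Rightarrow> real) \<Rightarrow> real \<Rightarrow> real \<Rightarrow> real" where
  "cost Q n t = Q t + \<beta> n * max (- t) 0 + \<gamma> n * max t 0"

text \<open>A function on \<open>T\<close> is represented by the total function that agrees with it on \<open>T\<close> and is
  \<^const>\<open>undefined\<close> elsewhere, so that equality of profiles is equality on \<open>T\<close> and a
  dynamic process cannot depend on values outside \<open>T\<close>.\<close>

definition Q_hat :: "real \<Rightarrow> real" where
  "Q_hat = (\<lambda>t\<in>T. if t \<le> 0 then 1 / s * integral {0..idx t} \<beta>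
              else 1 / s * integral {0..idx 0} \<beta> - 1 / s * integral {N1..idx t} \<gamma>)"

text \<open>The derivative of a profile is required to be continuous off a finite set of breakpoints;
  one-sided limits of the derivative at the breakpoints are not required to exist.\<close>

definition profiles :: "(real \<Rightarrow> real) set" where
  "profiles = {Q \<in> T \<rightarrow>\<^sub>E {0..}.
     (\<forall>t\<in>interior T. 0 < Q t) \<and> Q tau_s = 0 \<and> Q tau_e = 0 \<and>
     continuous_on T Q \<and> Q piecewise_C1_differentiable_on T \<and>
     (\<forall>t1\<in>T. \<forall>t2\<in>T. t1 < t2 \<longrightarrow> Q t2 - Q t1 < t2 - t1)}"

text \<open>The index \<open>idx t\<close> is held fixed when differentiating: only the arrival time \<open>u\<close> varies.\<close>

definition OLP :: "((real \<Rightarrow> real) \<Rightarrow> (real \<Rightarrow> real)) \<Rightarrow> bool" where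
  "OLP Y \<longleftrightarrow> Y \<in> profiles \<rightarrow> profiles \<and>
     (\<forall>Q\<in>profiles. \<forall>t\<in>interior T. t \<noteq> 0 \<longrightarrow> Q differentiable at t \<longrightarrow>
        0 \<le> (Y Q t - Q t) * deriv (\<lambda>u. cost Q (idx t) u) t)"

text \<open>On profiles the supremum is attained, by continuity on the compact interval \<open>T\<close>.\<close>

definition profile_dist :: "(real \<Rightarrow> real) \<Rightarrow> (real \<Rightarrow> real) \<Rightarrow> real" where
  "profile_dist Q1 Q2 = (SUP t\<in>T. \<bar>Q1 t - Q2 t\<bar>)"

definition converging :: "((real \<Rightarrow> real) \<Rightarrow> (real \<Rightarrow> real)) \<Rightarrow> bool" where
  "converging Y \<longleftrightarrow> Y \<in> profiles \<rightarrow> profiles \<and> Y Q_hat = Q_hat \<and>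
     (\<exists>\<epsilon>>0. \<forall>Q\<in>profiles. profile_dist Q Q_hat < \<epsilon> \<longrightarrow>
        (\<lambda>k. profile_dist ((Y ^^ k) Q) Q_hat) \<longlonglongrightarrow> 0)"

definition unstable_wrt :: "((real \<Rightarrow> real) \<Rightarrow> (real \<Rightarrow> real)) set \<Rightarrow> bool" where
  "unstable_wrt \<Y> \<longleftrightarrow> \<not> (\<exists>Y\<in>\<Y>. converging Y)"

lemma cost_deriv:
  assumes "Q differentiable at t" "t \<noteq> 0"
  shows "deriv (\<lambda>u. cost Q n u) t = deriv Q t + (if t < 0 then - \<beta> n else \<gamma> n)"
proof -
  have Q: "(Q has_real_derivative deriv Q t) (at t)"
    using assms(1) by (simp add: DERIV_deriv_iff_real_differentiable)
  have "(cost Q n has_real_derivative deriv Q t + (if t < 0 then - \<beta> n else \<gamma> n)) (at t)"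
  proof (cases "t < 0")
    case True
    have "((\<lambda>u. Q u + \<beta> n * (- u)) has_real_derivative deriv Q t - \<beta> n) (at t)"
      using Q by (auto intro!: derivative_eq_intros)
    then have "(cost Q n has_real_derivative deriv Q t - \<beta> n) (at t)"
      by (rule has_field_derivative_transform_within_open[where S = "{..<0}"])
        (use True in \<open>auto simp: cost_def\<close>)
    then show ?thesis using True by simp
  next
    case False
    have "((\<lambda>u. Q u + \<gamma> n * u) has_real_derivative deriv Q t + \<gamma> n) (at t)"
      using Q by (auto intro!: derivative_eq_intros)
    then have "(cost Q n has_real_derivative deriv Q t + \<gamma> n) (at t)"
      by (rule has_field_derivative_transform_within_open[where S = "{0<..}"])
        (use False assms(2) in \<open>auto simp: cost_def\<close>)
    then show ?thesis using False by simp
  qed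
  then show ?thesis by (simp add: DERIV_imp_deriv)
qed

lemma beta_int: "0 \<le> a \<Longrightarrow> b \<le> N \<Longrightarrow> \<beta> integrable_on {a..b}"
  by (intro integrable_continuous_real continuous_on_subset[OF beta_cont]) auto

lemma gamma_int: "0 \<le> a \<Longrightarrow> b \<le> N \<Longrightarrow> \<gamma> integrable_on {a..b}"
  by (intro integrable_continuous_real continuous_on_subset[OF gamma_cont]) auto

lemma integral_pos:
  fixes f :: "real \<Rightarrow> real"
  assumes "a < b" "continuous_on {a..b} f" "\<And>x. x \<in> {a..b} \<Longrightarrow> 0 < f x"
  shows "0 < integral {a..b} f"
proof -
  obtain m where m: "m \<in> {a..b}" "\<And>x. x \<in> {a..b} \<Longrightarrow> f m \<le> f x"
    using continuous_attains_inf[of "{a..b}" f] assms by auto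
  have "integral {a..b} (\<lambda>x. f m) \<le> integral {a..b} f"
    by (intro integral_le integrable_continuous_real) (use assms m in auto)
  moreover have "0 < (b - a) * f m" using assms m by simp
  ultimately show ?thesis using assms(1) by simp
qed

lemma N1_ex1: "\<exists>!x. x \<in> {0<..<N} \<and> integral {0..x} \<beta> = integral {x..N} \<gamma>"
proof -
  define F where "F x = integral {0..x} \<beta> - integral {x..N} \<gamma>" for x
  have bpos: "0 < integral {a..b} \<beta>" if "0 \<le> a" "a < b" "b \<le> N" for a b
    by (rule integral_pos) (use that beta_range in
      \<open>auto intro: continuous_on_subset[OF beta_cont]\<close>)
  have gpos: "0 < integral {a..b} \<gamma>" if "0 \<le> a" "a < b" "b \<le> N" for a b
    by (rule integral_pos) (use that gamma_range in
      \<open>auto intro: continuous_on_subset[OF gamma_cont]\<close>)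
  have less: "F x < F y" if "0 \<le> x" "x < y" "y \<le> N" for x y
  proof -
    have "integral {0..x} \<beta> + integral {x..y} \<beta> = integral {0..y} \<beta>"
      by (rule Henstock_Kurzweil_Integration.integral_combine) (use that beta_int in auto)
    moreover have "integral {x..y} \<gamma> + integral {y..N} \<gamma> = integral {x..N} \<gamma>"
      by (rule Henstock_Kurzweil_Integration.integral_combine) (use that gamma_int in auto)
    ultimately show ?thesis using bpos[OF that] gpos[OF that] by (simp add: F_def)
  qed
  have cont: "continuous_on {0..N} F"
    unfolding F_def
    by (intro continuous_intros indefinite_integral_continuous_1
        indefinite_integral_continuous_1' beta_int gamma_int) auto
  have "F 0 < 0" "0 < F N"
    using bpos[of 0 N] gpos[of 0 N] N_pos by (auto simp: F_def)
  then obtain x where x: "0 \<le> x" "x \<le> N" "F x = 0"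
    using IVT'[of F 0 0 N] cont N_pos by auto
  have "x \<noteq> 0" "x \<noteq> N" using x \<open>F 0 < 0\<close> \<open>0 < F N\<close> by auto
  then have "x \<in> {0<..<N} \<and> F x = 0" using x by auto
  moreover have "y = x" if "y \<in> {0<..<N}" "F y = 0" for y
    using less[of x y] less[of y x] x that by (cases x y rule: linorder_cases) auto
  ultimately show ?thesis unfolding F_def by (intro ex1I[of _ x]) auto
qed

lemma N1_bounds: "0 < N1" "N1 < N"
  and N1_balance: "integral {0..N1} \<beta> = integral {N1..N} \<gamma>"
  using theI'[OF N1_ex1] unfolding N1_def by auto

lemma T_facts:
  shows "tau_s < 0" "0 < tau_e" "idx tau_s = 0" "idx tau_e = N" "idx 0 = N1"
    and "T = {tau_s..tau_e}" "interior T = {tau_s<..<tau_e}"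
  using N1_bounds s_pos
  by (auto simp: tau_s_def tau_e_def idx_def T_def field_simps interior_atLeastAtMost_real)

lemma idx_strict_mono: "idx t < idx u \<longleftrightarrow> t < u" "idx t \<le> idx u \<longleftrightarrow> t \<le> u"
  using s_pos by (auto simp: idx_def)

lemma idx_deriv: "(idx has_real_derivative s) (at t)"
proof -
  have "((\<lambda>t. N1 + s * t) has_real_derivative s) (at t)"
    by (auto intro!: derivative_eq_intros)
  then show ?thesis by (simp add: idx_def[abs_def])
qed

lemma idx_bounds: "t \<in> T \<Longrightarrow> idx t \<in> {0..N}"
  using idx_strict_mono(2)[of tau_s t] idx_strict_mono(2)[of t tau_e] T_facts by auto

lemma Q_hat_left: "t \<in> T \<Longrightarrow> t \<le> 0 \<Longrightarrow> Q_hat t = integral {0..idx t} \<beta> / s"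
  by (simp add: Q_hat_def)

lemma Q_hat_right:
  assumes "t \<in> T" "0 \<le> t"
  shows "Q_hat t = integral {idx t..N} \<gamma> / s"
proof (cases "t = 0")
  case True
  then show ?thesis using assms N1_balance T_facts by (simp add: Q_hat_def)
next
  case False
  have "integral {N1..idx t} \<gamma> + integral {idx t..N} \<gamma> = integral {N1..N} \<gamma>"
    by (rule Henstock_Kurzweil_Integration.integral_combine)
      (use assms N1_bounds idx_bounds[of t] idx_strict_mono(2)[of 0 t] T_facts gamma_int in auto)
  then show ?thesis
    using assms False N1_balance T_facts
    by (simp add: Q_hat_def diff_divide_distrib[symmetric])
qed

lemma Q_hat_cont: "continuous_on T Q_hat"
proof -
  have B: "continuous_on {0..N} (\<lambda>x. integral {0..x} \<beta>)"
    by (intro indefinite_integral_continuous_1 beta_int) auto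
  have G: "continuous_on {0..N} (\<lambda>x. integral {x..N} \<gamma>)"
    by (intro indefinite_integral_continuous_1' gamma_int) auto
  have idx: "continuous_on A idx" for A
    unfolding idx_def by (intro continuous_intros)
  have l: "continuous_on {tau_s..0} Q_hat"
  proof (rule continuous_on_eq)
    show "continuous_on {tau_s..0} (\<lambda>t. integral {0..idx t} \<beta> / s)"
      using s_pos idx_bounds T_facts
      by (intro continuous_intros continuous_on_compose2[OF B idx]) auto
  qed (use Q_hat_left T_facts in auto)
  have r: "continuous_on {0..tau_e} Q_hat"
  proof (rule continuous_on_eq)
    show "continuous_on {0..tau_e} (\<lambda>t. integral {idx t..N} \<gamma> / s)"
      using s_pos idx_bounds T_facts
      by (intro continuous_intros continuous_on_compose2[OF G idx]) auto
  qed (use Q_hat_right T_facts in auto)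
  have T: "T = {tau_s..0} \<union> {0..tau_e}" using T_facts(1,2) by (auto simp: T_def)
  show ?thesis unfolding T by (rule continuous_on_closed_Un[OF _ _ l r]) auto
qed

lemma Q_hat_deriv_left:
  assumes "tau_s < t" "t < 0"
  shows "(Q_hat has_real_derivative \<beta> (idx t)) (at t)"
proof -
  have i: "0 < idx t" "idx t < N"
    using idx_strict_mono(1)[of tau_s t] idx_strict_mono(1)[of t tau_e] T_facts assms by auto
  have "((\<lambda>x. integral {0..x} \<beta>) has_real_derivative \<beta> (idx t)) (at (idx t) within {0..N})"
    by (rule integral_has_real_derivative[OF beta_cont]) (use i in auto)
  then have "((\<lambda>x. integral {0..x} \<beta>) has_real_derivative \<beta> (idx t)) (at (idx t))"
    using i by (simp only: at_within_Icc_at)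
  moreover have "(idx has_real_derivative s) (at t)"
    by (rule idx_deriv)
  ultimately have "((\<lambda>u. integral {0..idx u} \<beta>) has_real_derivative \<beta> (idx t) * s) (at t)"
    by (rule DERIV_chain2)
  from DERIV_cdivide[OF this, of s]
  have der: "((\<lambda>u. integral {0..idx u} \<beta> / s) has_real_derivative \<beta> (idx t)) (at t)"
    using s_pos by simp
  have eq: "integral {0..idx x} \<beta> / s = Q_hat x" if "x \<in> {tau_s<..<0}" for x
    using Q_hat_left[of x] that T_facts(1,2) by (simp add: T_def)
  have "t \<in> {tau_s<..<0}" using assms by simp
  from has_field_derivative_transform_within_open[OF der open_greaterThanLessThan this eq]
  show ?thesis by assumption
qed

lemma Q_hat_deriv_right:
  assumes "0 < t" "t < tau_e"
  shows "(Q_hat has_real_derivative - \<gamma> (idx t)) (at t)"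
proof -
  have i: "0 < idx t" "idx t < N"
    using idx_strict_mono(1)[of tau_s t] idx_strict_mono(1)[of t tau_e] T_facts assms by auto
  have "((\<lambda>x. integral {x..N} \<gamma>) has_real_derivative - \<gamma> (idx t)) (at (idx t) within {0..N})"
    by (rule integral_has_real_derivative'[OF gamma_cont]) (use i in auto)
  then have "((\<lambda>x. integral {x..N} \<gamma>) has_real_derivative - \<gamma> (idx t)) (at (idx t))"
    using i by (simp only: at_within_Icc_at)
  moreover have "(idx has_real_derivative s) (at t)"
    by (rule idx_deriv)
  ultimately have "((\<lambda>u. integral {idx u..N} \<gamma>) has_real_derivative - \<gamma> (idx t) * s) (at t)"
    by (rule DERIV_chain2)
  from DERIV_cdivide[OF this, of s]
  have der: "((\<lambda>u. integral {idx u..N} \<gamma> / s) has_real_derivative - \<gamma> (idx t)) (at t)"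
    using s_pos by simp
  have eq: "integral {idx x..N} \<gamma> / s = Q_hat x" if "x \<in> {0<..<tau_e}" for x
    using Q_hat_right[of x] that T_facts(1,2) by (simp add: T_def)
  have "t \<in> {0<..<tau_e}" using assms by simp
  from has_field_derivative_transform_within_open[OF der open_greaterThanLessThan this eq]
  show ?thesis by assumption
qed

lemma Q_hat_piecewise_C1: "Q_hat piecewise_C1_differentiable_on T"
proof -
  define D where "D t = (if t < 0 then \<beta> (idx t) else - \<gamma> (idx t))" for t
  have sub: "T - {tau_s, 0, tau_e} = {tau_s<..<0} \<union> {0<..<tau_e}"
    using T_facts(1,2) by (auto simp: T_def)
  have idx: "continuous_on A idx" for A
    unfolding idx_def by (intro continuous_intros)
  have "continuous_on {tau_s<..<0} D"
  proof (rule continuous_on_eq)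
    show "continuous_on {tau_s<..<0} (\<lambda>t. \<beta> (idx t))"
      using idx_bounds T_facts by (intro continuous_on_compose2[OF beta_cont idx]) auto
  qed (auto simp: D_def)
  moreover have "continuous_on {0<..<tau_e} D"
  proof (rule continuous_on_eq)
    show "continuous_on {0<..<tau_e} (\<lambda>t. - \<gamma> (idx t))"
      using idx_bounds T_facts
      by (intro continuous_intros continuous_on_compose2[OF gamma_cont idx]) auto
  qed (auto simp: D_def)
  ultimately have "continuous_on ({tau_s<..<0} \<union> {0<..<tau_e}) D"
    by (intro continuous_on_open_Un) auto
  moreover have "(Q_hat has_real_derivative D t) (at t)" if "t \<in> T - {tau_s, 0, tau_e}" for t
    using that Q_hat_deriv_left[of t] Q_hat_deriv_right[of t] unfolding sub
    by (auto simp: D_def)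
  ultimately have "Q_hat C1_differentiable_on (T - {tau_s, 0, tau_e})"
    unfolding C1_differentiable_on_def sub has_real_derivative_iff_has_vector_derivative
    by blast
  then show ?thesis
    unfolding piecewise_C1_differentiable_on_def
    using Q_hat_cont by (intro conjI exI[of _ "{tau_s, 0, tau_e}"]) auto
qed

lemma Q_hat_in_profiles: "Q_hat \<in> profiles"
proof -
  have pos: "0 < Q_hat t" if "t \<in> {tau_s<..<tau_e}" for t
  proof (cases "t \<le> 0")
    case True
    have "0 < integral {0..idx t} \<beta>"
      by (rule integral_pos)
        (use that beta_range idx_strict_mono(1)[of tau_s t] idx_bounds[of t] T_facts in
          \<open>auto intro!: continuous_on_subset[OF beta_cont]\<close>)
    then show ?thesis using True that s_pos T_facts Q_hat_left[of t] by simp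
  next
    case False
    have "0 < integral {idx t..N} \<gamma>"
      by (rule integral_pos)
        (use that gamma_range idx_strict_mono(1)[of t tau_e] idx_bounds[of t] T_facts in
          \<open>auto intro!: continuous_on_subset[OF gamma_cont]\<close>)
    then show ?thesis using False that s_pos T_facts Q_hat_right[of t] by simp
  qed
  have ends: "Q_hat tau_s = 0" "Q_hat tau_e = 0"
    using Q_hat_left[of tau_s] Q_hat_right[of tau_e] T_facts by auto
  have slope: "\<exists>z l. t < z \<and> z < u \<and> DERIV Q_hat z :> l \<and> Q_hat u - Q_hat t = (u - t) * l"
    if "tau_s \<le> t" "t < u" "u \<le> tau_e" "u \<le> 0 \<or> 0 \<le> t" for t u
  proof -
    have "Q_hat differentiable at x" if "t < x" "x < u" for x
      using that \<open>tau_s \<le> t\<close> \<open>u \<le> tau_e\<close> \<open>u \<le> 0 \<or> 0 \<le> t\<close>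
        Q_hat_deriv_left[of x] Q_hat_deriv_right[of x]
      by (cases "x < 0") (auto simp: real_differentiable_def)
    moreover have "continuous_on {t..u} Q_hat"
      using that T_facts by (auto intro: continuous_on_subset[OF Q_hat_cont])
    ultimately show ?thesis using MVT[OF \<open>t < u\<close>, of Q_hat] by blast
  qed
  have slope_l: "Q_hat u - Q_hat t < u - t" if tu: "tau_s \<le> t" "t < u" "u \<le> 0" for t u
  proof -
    obtain z l where z: "t < z" "z < u" "DERIV Q_hat z :> l" "Q_hat u - Q_hat t = (u - t) * l"
      using slope[of t u] tu T_facts by auto
    have "l = \<beta> (idx z)"
      using DERIV_unique[OF z(3) Q_hat_deriv_left] z tu by auto
    then have "l < 1" using beta_range idx_bounds[of z] z tu T_facts by auto
    then show ?thesis using z tu by simp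
  qed
  have slope_r: "Q_hat u - Q_hat t \<le> 0" if tu: "0 \<le> t" "t < u" "u \<le> tau_e" for t u
  proof -
    obtain z l where z: "t < z" "z < u" "DERIV Q_hat z :> l" "Q_hat u - Q_hat t = (u - t) * l"
      using slope[of t u] tu T_facts by auto
    have "l = - \<gamma> (idx z)"
      using DERIV_unique[OF z(3) Q_hat_deriv_right] z tu by auto
    moreover have "0 < \<gamma> (idx z)" using gamma_range idx_bounds[of z] z tu T_facts by auto
    ultimately show ?thesis using z tu by (simp add: mult_nonneg_nonpos)
  qed
  have "Q_hat u - Q_hat t < u - t" if "t \<in> T" "u \<in> T" "t < u" for t u
    using slope_l[of t u] slope_l[of t 0] slope_r[of t u] slope_r[of 0 u] that T_facts
    by (cases "u \<le> 0"; cases "0 \<le> t"; cases "u = 0"; cases "t = 0") auto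
  moreover have "Q_hat \<in> T \<rightarrow>\<^sub>E {0..}"
  proof
    fix t assume "t \<in> T"
    then show "Q_hat t \<in> {0..}"
      using pos[of t] ends T_facts by (cases "t = tau_s \<or> t = tau_e") auto
  qed (simp add: Q_hat_def)
  ultimately show ?thesis
    using pos ends Q_hat_cont Q_hat_piecewise_C1 T_facts by (simp add: profiles_def)
qed

end

end

theory Submission
  imports Defs
begin

text \<open>Let \<open>D\<close> be the deviation of a profile \<open>Q\<close> from \<open>Q_hat\<close>. The cost derivative at \<open>t\<close> is
  \<open>D' t\<close>, so an OLP map may only raise \<open>Q\<close> where \<open>D\<close> increases. At the first time \<open>D\<close> reaches a
  level \<open>c > 0\<close>, there are points of increase of \<open>D\<close> arbitrarily close on the left, so by continuity
  \<open>Q\<close> cannot be lowered there: the maximum of \<open>D\<close> never decreases along the iteration. Hence any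
  profile that exceeds \<open>Q_hat\<close> somewhere stays away from \<open>Q_hat\<close>, and such profiles exist
  arbitrarily close to \<open>Q_hat\<close>.\<close>

section \<open>Real analysis: first passage times and piecewise C1 functions\<close>

text \<open>Before its first passage \<open>p\<close> through level \<open>c\<close>,
  \<open>D\<close> stays below \<open>c\<close>, so the mean value theorem on short intervals ending
  at \<open>p\<close> yields positive derivatives. These points only accumulate at \<open>p\<close>
  from the left, because \<open>p\<close> itself may be exceptional.\<close>

lemma first_passage_increase:
  fixes D :: "real \<Rightarrow> real"
  assumes cont: "continuous_on {a..b} D" and "finite S"
    and diff: "\<And>x. x \<in> {a<..<b} - S \<Longrightarrow> D differentiable at x"
    and "D a < c" "t0 \<in> {a..b}" "c \<le> D t0"
  obtains p where "p \<in> {a<..b}" "c \<le> D p"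
    "\<And>e. 0 < e \<Longrightarrow> \<exists>z\<in>{p - e<..<p} \<inter> {a<..<b} - S. 0 < deriv D z"
proof -
  define L where "L = {t \<in> {a..b}. c \<le> D t}"
  have "closed L" unfolding L_def
    using continuous_on_closed_Collect_le[OF continuous_on_const cont closed_atLeastAtMost] .
  moreover have "bounded L" unfolding L_def by (rule bounded_subset[of "{a..b}"]) auto
  ultimately have "compact L" by (simp add: compact_eq_bounded_closed)
  moreover have "L \<noteq> {}" using assms(5,6) by (auto simp: L_def)
  ultimately obtain p where p: "p \<in> L" "\<And>t. t \<in> L \<Longrightarrow> p \<le> t"
    using compact_attains_inf[of L] by metis
  have "p \<noteq> a" using p(1) assms(4) by (auto simp: L_def)
  then have pab: "a < p" "p \<le> b" "c \<le> D p" using p(1) by (auto simp: L_def)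
  show thesis
  proof (rule that[of p])
    show "p \<in> {a<..b}" "c \<le> D p" using pab by auto
    fix e :: real assume "0 < e"
    \<comment> \<open>All points strictly between \<open>q\<close> and \<open>p\<close> are within
      \<open>e\<close> of \<open>p\<close>, to the right of \<open>a\<close> and outside
      \<open>S\<close>.\<close>
    define q where "q = Max (insert (p - e) (insert a (S \<inter> {..<p})))"
    have fin: "finite (insert (p - e) (insert a (S \<inter> {..<p})))" using \<open>finite S\<close> by simp
    have "q < p" unfolding q_def using fin pab \<open>0 < e\<close> by (subst Max_less_iff) auto
    have q: "p - e \<le> q" "a \<le> q" "\<And>x. x \<in> S \<Longrightarrow> x < p \<Longrightarrow> x \<le> q"
      using Max_ge[OF fin, folded q_def] by simp_all
    define r where "r = (q + p) / 2"
    have r: "q < r" "r < p" using \<open>q < p\<close> by (auto simp: r_def)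
    have "D differentiable at x" if "r < x" "x < p" for x
    proof (rule diff)
      have "x \<notin> S" using q(3)[of x] that r by auto
      then show "x \<in> {a<..<b} - S" using that r q pab by auto
    qed
    moreover have "continuous_on {r..p} D"
      using r q pab by (auto intro: continuous_on_subset[OF cont])
    ultimately obtain l z where z: "r < z" "z < p" "DERIV D z :> l" "D p - D r = (p - r) * l"
      using MVT[OF r(2), of D] by metis
    \<comment> \<open>\<open>r\<close> precedes the minimum \<open>p\<close> of \<open>L\<close>, so
      \<open>D r < c \<le> D p\<close> and the slope \<open>l\<close> is positive.\<close>
    have "r \<notin> L" using p(2)[of r] r by auto
    then have "D r < D p" using r q pab by (auto simp: L_def)
    then have "0 < l" using z(4) r zero_less_mult_pos[of "p - r" l] by simp
    moreover have "z \<in> {p - e<..<p} \<inter> {a<..<b} - S"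
    proof -
      have "z \<notin> S" using q(3)[of z] z r by auto
      then show ?thesis using z r q pab by auto
    qed
    moreover have "deriv D z = l" by (rule DERIV_imp_deriv[OF z(3)])
    ultimately show "\<exists>z\<in>{p - e<..<p} \<inter> {a<..<b} - S. 0 < deriv D z"
      by (intro bexI[of _ z]) simp_all
  qed
qed

lemma C1_differentiable_on_cong_open:
  assumes "f C1_differentiable_on U" "open U" "\<And>x. x \<in> U \<Longrightarrow> g x = f x"
  shows "g C1_differentiable_on U"
proof -
  obtain D where D: "\<And>x. x \<in> U \<Longrightarrow> (f has_vector_derivative D x) (at x)" "continuous_on U D"
    using assms(1) unfolding C1_differentiable_on_def by blast
  have "(g has_vector_derivative D x) (at x)" if "x \<in> U" for x
    by (rule has_vector_derivative_transform_within_open[OF D(1)[OF that] assms(2) that])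
      (use assms(3) in auto)
  then show ?thesis unfolding C1_differentiable_on_def using D(2) by blast
qed

text \<open>Serves for profiles, which are \<open>undefined\<close> off \<open>T\<close>. The
  derivatives are two-sided and at \<open>a\<close> and \<open>b\<close> depend on values outside
  the interval, so both endpoints join the exceptional set.\<close>

lemma piecewise_C1_differentiable_on_cong_Icc:
  fixes f g :: "real \<Rightarrow> real"
  assumes f: "f piecewise_C1_differentiable_on {a..b}" and eq: "\<And>x. x \<in> {a..b} \<Longrightarrow> g x = f x"
  shows "g piecewise_C1_differentiable_on {a..b}"
proof -
  obtain S where S: "finite S" "f C1_differentiable_on ({a..b} - S)"
    using f unfolding piecewise_C1_differentiable_on_def by blast
  have "open ({a<..<b} - S)" using finite_imp_closed[OF S(1)] by auto
  moreover have sub: "{a..b} - (insert a (insert b S)) \<subseteq> {a<..<b} - S" "{a<..<b} - S \<subseteq> {a..b} - S"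
    by auto
  ultimately have "g C1_differentiable_on ({a<..<b} - S)"
    using C1_differentiable_on_cong_open[OF C1_differentiable_on_subset[OF S(2) sub(2)]] eq by auto
  then have "g C1_differentiable_on ({a..b} - (insert a (insert b S)))"
    using C1_differentiable_on_subset sub(1) by blast
  moreover have "continuous_on {a..b} g"
    using f eq continuous_on_cong[of "{a..b}" "{a..b}" g f]
    unfolding piecewise_C1_differentiable_on_def by simp
  ultimately show ?thesis
    unfolding piecewise_C1_differentiable_on_def using S(1) by (meson finite_insert)
qed

context bottleneck
begin

section \<open>OLP maps and the deviation from equilibrium\<close>

lemma profilesD:
  assumes "Q \<in> profiles"
  shows "continuous_on T Q" "Q tau_s = 0" "Q tau_e = 0"
    "\<exists>S. finite S \<and> (\<forall>x\<in>T - S. Q differentiable at x)"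
proof -
  show "continuous_on T Q" "Q tau_s = 0" "Q tau_e = 0" using assms by (auto simp: profiles_def)
  have "Q piecewise_C1_differentiable_on T" using assms by (auto simp: profiles_def)
  then show "\<exists>S. finite S \<and> (\<forall>x\<in>T - S. Q differentiable at x)"
    unfolding piecewise_C1_differentiable_on_def C1_differentiable_on_def
    by (meson differentiableI_vector)
qed

text \<open>At equilibrium the marginal cost of traveler \<open>idx t\<close> vanishes at
  \<open>t\<close>: \<open>Q_hat\<close> has slope \<open>\<beta> (idx t)\<close> before
  \<open>0\<close> and \<open>- \<gamma> (idx t)\<close> after it, exactly cancelling the schedule
  cost terms.\<close>

lemma deriv_cost_eq_deriv_deviation:
  assumes "t \<in> interior T" "t \<noteq> 0" "Q differentiable at t"
  shows "deriv (\<lambda>u. cost Q (idx t) u) t = deriv (\<lambda>u. Q u - Q_hat u) t"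
proof -
  have Q: "(Q has_real_derivative deriv Q t) (at t)"
    using assms(3) by (simp add: DERIV_deriv_iff_real_differentiable)
  have "(Q_hat has_real_derivative (if t < 0 then \<beta> (idx t) else - \<gamma> (idx t))) (at t)"
    using assms(1,2) Q_hat_deriv_left[of t] Q_hat_deriv_right[of t] T_facts by auto
  from DERIV_imp_deriv[OF DERIV_diff[OF Q this]] show ?thesis
    using cost_deriv[OF assms(3,2), of "idx t"] by auto
qed

lemma OLP_level_preserved:
  assumes Y: "OLP Y" and Q: "Q \<in> profiles" and c: "0 < c"
    and t0: "t0 \<in> T" "c \<le> Q t0 - Q_hat t0"
  shows "\<exists>t\<in>T. c \<le> Y Q t - Q_hat t"
proof -
  have YQ: "Y Q \<in> profiles" using Y Q by (auto simp: OLP_def)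
  obtain S where S: "finite S" "\<And>x. x \<in> T - S \<Longrightarrow> Q differentiable at x"
    using profilesD(4)[OF Q] by blast
  define D where "D = (\<lambda>u. Q u - Q_hat u)"
  have Q_hat_diff: "Q_hat differentiable at x" if "x \<in> {tau_s<..<tau_e}" "x \<noteq> 0" for x
    using that Q_hat_deriv_left[of x] Q_hat_deriv_right[of x]
    by (cases "x < 0") (auto simp: real_differentiable_def)
  have cont: "continuous_on {tau_s..tau_e} D" unfolding D_def
    using profilesD(1)[OF Q] Q_hat_cont by (auto intro!: continuous_intros simp: T_def)
  \<comment> \<open>\<open>0\<close> joins the breakpoints: the slope of \<open>Q_hat\<close> jumps
    there from positive to negative, and OLP imposes no condition at that time.\<close>
  have diff: "D differentiable at x" if "x \<in> {tau_s<..<tau_e} - insert 0 S" for x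
    unfolding D_def using that S(2)[of x] Q_hat_diff[of x]
    by (intro differentiable_diff) (auto simp: T_def)
  have low: "D tau_s < c" using profilesD(2)[OF Q] profilesD(2)[OF Q_hat_in_profiles] c
    by (simp add: D_def)
  obtain p where p: "p \<in> {tau_s<..tau_e}" "c \<le> D p" and
    incr: "\<And>e. 0 < e \<Longrightarrow> \<exists>z\<in>{p - e<..<p} \<inter> {tau_s<..<tau_e} - insert 0 S. 0 < deriv D z"
  proof (rule first_passage_increase[of tau_s tau_e D "insert 0 S" c t0])
    show "D differentiable at x" if "x \<in> {tau_s<..<tau_e} - insert 0 S" for x
      using that by (rule diff)
  qed (use S(1) t0 cont low in \<open>simp_all add: T_def D_def\<close>)
  \<comment> \<open>OLP need not apply at \<open>p\<close> itself. But a strict drop at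
    \<open>p\<close> would persist nearby by continuity, including at some \<open>z\<close> where
    \<open>D\<close> increases and OLP forbids it.\<close>
  have "Q p \<le> Y Q p"
  proof (rule ccontr)
    assume neg: "\<not> Q p \<le> Y Q p"
    have "continuous_on T (\<lambda>u. Q u - Y Q u)"
      using profilesD(1)[OF Q] profilesD(1)[OF YQ] by (intro continuous_intros)
    moreover have "p \<in> T" using p by (auto simp: T_def)
    ultimately obtain e where e: "0 < e"
      "\<And>u. u \<in> T \<Longrightarrow> dist u p < e \<Longrightarrow> dist (Q u - Y Q u) (Q p - Y Q p) < Q p - Y Q p"
      using neg continuous_on_iff[THEN iffD1, rule_format, of T _ p "Q p - Y Q p"] by force
    obtain z where z: "z \<in> {p - e<..<p}" "z \<in> {tau_s<..<tau_e}" "z \<noteq> 0" "z \<notin> S" "0 < deriv D z"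
      using incr[OF e(1)] by blast
    have "z \<in> interior T" "z \<in> T" using z T_facts by auto
    moreover have "Q differentiable at z" using S(2) z \<open>z \<in> T\<close> by auto
    ultimately have "0 \<le> (Y Q z - Q z) * deriv D z"
      using Y Q z deriv_cost_eq_deriv_deviation[of z Q] unfolding OLP_def D_def by metis
    then have "Q z \<le> Y Q z" using z(5) by (simp add: zero_le_mult_iff)
    then show False using e(2)[OF \<open>z \<in> T\<close>] z(1) neg by (auto simp: dist_real_def)
  qed
  then show ?thesis using p by (intro bexI[of _ p]) (auto simp: D_def T_def)
qed

lemma OLP_funpow_level_preserved:
  assumes "OLP Y" "Q \<in> profiles" "0 < c" "\<exists>t\<in>T. c \<le> Q t - Q_hat t"
  shows "(Y ^^ k) Q \<in> profiles \<and> (\<exists>t\<in>T. c \<le> (Y ^^ k) Q t - Q_hat t)"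
proof (induction k)
  case (Suc k)
  moreover have "Y \<in> profiles \<rightarrow> profiles" using assms(1) by (simp add: OLP_def)
  ultimately show ?case using OLP_level_preserved[OF assms(1) _ assms(3)] by auto
qed (use assms in auto)

section \<open>The uniform distance and profiles near equilibrium\<close>

lemma le_profile_dist:
  assumes "Q1 \<in> profiles" "Q2 \<in> profiles" "t \<in> T"
  shows "\<bar>Q1 t - Q2 t\<bar> \<le> profile_dist Q1 Q2"
  unfolding profile_dist_def
proof (rule cSUP_upper[OF assms(3)])
  have "compact ((\<lambda>t. \<bar>Q1 t - Q2 t\<bar>) ` T)"
    using assms profilesD(1)
    by (intro compact_continuous_image continuous_intros) (auto simp: T_def)
  then show "bdd_above ((\<lambda>t. \<bar>Q1 t - Q2 t\<bar>) ` T)"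
    by (intro bounded_imp_bdd_above compact_imp_bounded)
qed

lemma Q_hat_antimono_right:
  assumes "0 \<le> t" "t \<le> u" "u \<le> tau_e"
  shows "Q_hat u \<le> Q_hat t"
proof -
  have TT: "t \<in> T" "u \<in> T" using assms T_facts by auto
  have "integral {idx u..N} \<gamma> \<le> integral {idx t..N} \<gamma>"
    using idx_bounds[OF TT(1)] idx_bounds[OF TT(2)] idx_strict_mono(2)[of t u] assms gamma_range
    by (intro integral_subset_le gamma_int) (auto simp: Pi_iff less_imp_le)
  then show ?thesis using Q_hat_right TT assms s_pos by (simp add: divide_right_mono)
qed

text \<open>The perturbation is placed to the right of \<open>0\<close>, where \<open>Q_hat\<close> is nonincreasing, so that the
  slope bound \<open>< 1\<close> survives.\<close>

lemma exists_close_profile_above: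
  assumes "0 < \<epsilon>"
  shows "\<exists>Q\<in>profiles. profile_dist Q Q_hat < \<epsilon> \<and> (\<exists>t\<in>T. Q_hat t < Q t)"
proof -
  \<comment> \<open>\<open>e < 1\<close> leaves room in the slope bound;
    \<open>e * tau_e < \<epsilon>\<close> controls the distance.\<close>
  define e where "e = min 1 (\<epsilon> / tau_e) / 2"
  have te: "0 < tau_e" "tau_s < 0" using T_facts by auto
  have e: "0 < e" "e < 1" "e * tau_e < \<epsilon>"
    using te assms by (auto simp: e_def min_def field_simps)
  \<comment> \<open>A parabolic bump vanishing at \<open>0\<close> and \<open>tau_e\<close>; its
    steepest ascent is the slope \<open>e\<close> at \<open>0\<close>.\<close>
  define \<phi> where "\<phi> t = (if t \<le> 0 then 0 else e / tau_e * t * (tau_e - t))" for t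
  define Q where "Q = (\<lambda>t\<in>T. Q_hat t + \<phi> t)"
  have phi_pos: "0 < \<phi> t" if "0 < t" "t < tau_e" for t
    using that te e by (simp add: \<phi>_def)
  have phi_lip: "\<phi> u - \<phi> t \<le> e * (u - t)" if "0 \<le> t" "t \<le> u" "u \<le> tau_e" for t u
  proof -
    \<comment> \<open>The secant slope is \<open>e\<close> times a factor that is at most 1 since
      \<open>t + u \<ge> 0\<close>.\<close>
    have "\<phi> u - \<phi> t = e * (u - t) * ((tau_e - (t + u)) / tau_e)"
      using that te by (simp add: \<phi>_def field_simps)
    also have "\<dots> \<le> e * (u - t) * 1"
      using that te e by (intro mult_left_mono) (auto simp: field_simps)
    finally show ?thesis by simp
  qed
  have phi_bound: "0 \<le> \<phi> t" "\<phi> t \<le> e * tau_e" if "t \<in> T" for t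
  proof -
    have "t \<le> tau_e" using that by (simp add: T_def)
    then show "0 \<le> \<phi> t" using te e by (simp add: \<phi>_def)
    show "\<phi> t \<le> e * tau_e"
    proof (cases "t \<le> 0")
      case False
      then have "\<phi> t \<le> e * t" using phi_lip[of 0 t] \<open>t \<le> tau_e\<close> by (simp add: \<phi>_def)
      also have "\<dots> \<le> e * tau_e" using e \<open>t \<le> tau_e\<close> by simp
      finally show ?thesis .
    qed (use te e in \<open>simp add: \<phi>_def\<close>)
  qed
  have phi_pw: "\<phi> piecewise_C1_differentiable_on {tau_s..tau_e}"
    unfolding \<phi>_def
  proof (rule piecewise_C1_differentiable_cases)
    have "(\<lambda>t. e / tau_e * t * (tau_e - t)) C1_differentiable_on {0..tau_e}"
      by (intro derivative_intros)
    then show "(\<lambda>t. e / tau_e * t * (tau_e - t)) piecewise_C1_differentiable_on {0..tau_e}"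
      by (rule C1_differentiable_imp_piecewise)
  qed (use te in \<open>auto intro: C1_differentiable_imp_piecewise\<close>)
  have "Q \<in> profiles"
    unfolding profiles_def
  proof (intro CollectI conjI ballI impI)
    show "Q \<in> T \<rightarrow>\<^sub>E {0..}"
      using Q_hat_in_profiles phi_bound(1) by (auto simp: Q_def profiles_def PiE_iff)
    show "0 < Q t" if "t \<in> interior T" for t
      using Q_hat_in_profiles phi_bound(1)[of t] that interior_subset[of T]
      by (auto simp: Q_def profiles_def intro!: add_pos_nonneg)
    show "Q tau_s = 0" "Q tau_e = 0"
      using profilesD[OF Q_hat_in_profiles] te by (auto simp: Q_def \<phi>_def T_def)
    show pw: "Q piecewise_C1_differentiable_on T" unfolding T_def
    proof (rule piecewise_C1_differentiable_on_cong_Icc)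
      show "(\<lambda>t. Q_hat t + \<phi> t) piecewise_C1_differentiable_on {tau_s..tau_e}"
        using piecewise_C1_differentiable_add[OF Q_hat_piecewise_C1[unfolded T_def] phi_pw] .
    qed (simp add: Q_def T_def)
    then show "continuous_on T Q" by (simp add: piecewise_C1_differentiable_on_def)
    fix t u assume tu: "t \<in> T" "u \<in> T" "t < u"
    have right: "Q u - Q t < u - t" if "0 \<le> t" "t < u" "u \<le> tau_e" for t u
    proof -
      have "e * (u - t) < u - t" using that e by simp
      moreover have "Q u - Q t = (Q_hat u - Q_hat t) + (\<phi> u - \<phi> t)"
        using that te by (simp add: Q_def T_def)
      ultimately show ?thesis using phi_lip[of t u] Q_hat_antimono_right[of t u] that by linarith
    qed
    have left: "Q u - Q t < u - t" if "t \<in> T" "t < u" "u \<le> 0" for t u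
      using Q_hat_in_profiles that te by (simp add: Q_def profiles_def \<phi>_def T_def)
    \<comment> \<open>If \<open>t < 0 < u\<close>, the increment is split at \<open>0\<close> and
      the two bounds are added.\<close>
    show "Q u - Q t < u - t"
      using right[of t u] left[of t u] left[of t 0] right[of 0 u] tu te
      by (cases "u \<le> 0"; cases "0 \<le> t") (auto simp: T_def)
  qed
  moreover have "profile_dist Q Q_hat \<le> e * tau_e"
    unfolding profile_dist_def
  proof (rule cSUP_least)
    show "\<bar>Q t - Q_hat t\<bar> \<le> e * tau_e" if "t \<in> T" for t
      using phi_bound[OF that] that by (simp add: Q_def)
  qed (use te in \<open>simp add: T_def\<close>)
  moreover have "Q_hat (tau_e / 2) < Q (tau_e / 2)"
    using phi_pos[of "tau_e / 2"] te by (simp add: Q_def T_def)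
  moreover have "tau_e / 2 \<in> T" using te by (simp add: T_def)
  ultimately show ?thesis using e(3) by (meson le_less_trans)
qed

theorem Q_hat_unstable: "unstable_wrt {Y. OLP Y \<and> Y Q_hat = Q_hat}"
  unfolding unstable_wrt_def
proof
  assume "\<exists>Y\<in>{Y. OLP Y \<and> Y Q_hat = Q_hat}. converging Y"
  then obtain Y \<epsilon> where Y: "OLP Y" and "0 < \<epsilon>" and
    lim: "\<And>Q. Q \<in> profiles \<Longrightarrow> profile_dist Q Q_hat < \<epsilon> \<Longrightarrow>
        (\<lambda>k. profile_dist ((Y ^^ k) Q) Q_hat) \<longlonglongrightarrow> 0"
    unfolding converging_def by auto
  obtain Q t where Q: "Q \<in> profiles" "profile_dist Q Q_hat < \<epsilon>" "t \<in> T" "Q_hat t < Q t"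
    using exists_close_profile_above[OF \<open>0 < \<epsilon>\<close>] by blast
  \<comment> \<open>The level \<open>c\<close> is fixed before iterating: every iterate still
    attains it, which bounds all the distances below by one positive constant.\<close>
  define c where "c = Q t - Q_hat t"
  have "0 < c" using Q by (simp add: c_def)
  have "c \<le> profile_dist ((Y ^^ k) Q) Q_hat" for k
  proof -
    obtain u where "(Y ^^ k) Q \<in> profiles" "u \<in> T" "c \<le> (Y ^^ k) Q u - Q_hat u"
      using OLP_funpow_level_preserved[OF Y Q(1) \<open>0 < c\<close>, of k] Q(3) by (auto simp: c_def)
    then show ?thesis using le_profile_dist[OF _ Q_hat_in_profiles, of "(Y ^^ k) Q" u] by linarith
  qed
  then have "c \<le> 0" using lim[OF Q(1,2)] by (intro LIMSEQ_le_const) auto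
  then show False using \<open>0 < c\<close> by simp
qed

end

theorem theorem3:
  fixes \<beta> \<gamma> :: "real \<Rightarrow> real" and N s :: real
  assumes "bottleneck \<beta> \<gamma> N s"
  shows "bottleneck.unstable_wrt \<beta> \<gamma> N s
    {Y. bottleneck.OLP \<beta> \<gamma> N s Y \<and>
        Y (bottleneck.Q_hat \<beta> \<gamma> N s) = bottleneck.Q_hat \<beta> \<gamma> N s}"
  by (rule bottleneck.Q_hat_unstable[OF assms])

end
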